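(* Let $(a,b)$ be a finite interval and let $f\in C^{2}(a,b)\cap C^{1}[a,b]$ be a complex valued function such that $f(x)\neq 0$ for any $x\in[a,b]$. Let $x_{0}$ be an arbitrary point of the interval $[a,b]$ and let $\{\varphi_{k}\}_{k=0}^{\infty}$ be the system of functions defined by $$\varphi_{k}(x)=\begin{cases} f(x)X^{(k)}(x), & k \text{ odd},\\ f(x)\widetilde{X}^{(k)}(x), & k \text{ even},\end{cases}$$ where $X^{(k)},\widetilde X^{(k)}$ are the recursive integrals with base point $x_0$ defined in the context. Then for any complex valued piecewise continuously differentiable function $h$ defined on $[a,b]$ and for any $\varepsilon>0$ there exist $N\in\mathbb{N}$ and complex numbers $\alpha_{k}$, $k=0,1,\ldots,N$, such that $$\max_{x\in[a,b]}\left\vert h(x)-\sum_{k=0}^{N}\alpha_{k}\varphi_{k}(x)\right\vert<\varepsilon .$$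
   Context: Given $f$ nonvanishing on $[a,b]$ and a fixed point $x_{0}\in[a,b]$, define $\widetilde{X}^{(0)}(x)\equiv X^{(0)}(x)\equiv 1$ and, for $n\geq 1$, $$\widetilde{X}^{(n)}(x)=n\int_{x_{0}}^{x}\widetilde{X}^{(n-1)}(s)\left(f^{2}(s)\right)^{(-1)^{n-1}}\,ds,\qquad X^{(n)}(x)=n\int_{x_{0}}^{x}X^{(n-1)}(s)\left(f^{2}(s)\right)^{(-1)^{n}}\,ds .$$ Here $(f^2)^{1}=f^2$ and $(f^2)^{-1}=1/f^2$. *)

theory Defs
  imports "HOL-Analysis.Analysis"
begin

(* Derivatives are taken within S: one-sided at the endpoints of a closed interval,
   and the usual two-sided ones on an open interval. *)
fun Ck_on :: "nat \<Rightarrow> (real \<Rightarrow> complex) \<Rightarrow> real set \<Rightarrow> bool" where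
  "Ck_on 0 g S \<longleftrightarrow> continuous_on S g"
| "Ck_on (Suc n) g S \<longleftrightarrow>
     (\<exists>g'. (\<forall>x\<in>S. (g has_vector_derivative g' x) (at x within S)) \<and> Ck_on n g' S)"

(* LBINT s=x0..x is the oriented integral, so it changes sign when x < x0.
   The exponent (-1)^n is an integer and powi is the integer power, i.e. f^2 or 1/f^2. *)
primrec X_tilde :: "(real \<Rightarrow> complex) \<Rightarrow> real \<Rightarrow> nat \<Rightarrow> real \<Rightarrow> complex" where
  "X_tilde f x0 0 = (\<lambda>x. 1)"
| "X_tilde f x0 (Suc n) =
     (\<lambda>x. of_nat (Suc n) * (LBINT s=x0..x. X_tilde f x0 n s * ((f s)\<^sup>2) powi ((- 1) ^ n)))"

primrec X_plain :: "(real \<Rightarrow> complex) \<Rightarrow> real \<Rightarrow> nat \<Rightarrow> real \<Rightarrow> complex" where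
  "X_plain f x0 0 = (\<lambda>x. 1)"
| "X_plain f x0 (Suc n) =
     (\<lambda>x. of_nat (Suc n) * (LBINT s=x0..x. X_plain f x0 n s * ((f s)\<^sup>2) powi ((- 1) ^ Suc n)))"

definition phi :: "(real \<Rightarrow> complex) \<Rightarrow> real \<Rightarrow> nat \<Rightarrow> real \<Rightarrow> complex" where
  "phi f x0 k x = (if odd k then f x * X_plain f x0 k x else f x * X_tilde f x0 k x)"

end

theory Submission
  imports Defs
begin

text \<open>
  The functions \<open>\<phi>\<^sub>k\<close> are the images of the monomials \<open>(x - x\<^sub>0)\<^sup>k\<close> under a transmutation operator
  of the form identity plus Volterra operator, and such an operator maps the dense space of
  polynomials onto a dense space. The proof below gets the Volterra property without
  constructing an integral kernel.

  Put \<open>r = f'/f\<close>, let \<open>u\<^sub>k\<close> be \<open>\<phi>\<^sub>k\<close> rescaled by \<open>f(x\<^sub>0)\<^sup>\<plusminus>\<^sup>1\<close>, and let \<open>v\<^sub>k\<close> be its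
  companion built from the other recursive integral and \<open>1/f\<close>. The two recursions together become
  the first order system \<open>u\<^sub>k' = r u\<^sub>k + k v\<^sub>k\<^sub>-\<^sub>1\<close>, \<open>v\<^sub>k' = - r v\<^sub>k + k u\<^sub>k\<^sub>-\<^sub>1\<close>, with the values of the
  monomials at \<open>x\<^sub>0\<close>; for \<open>r = 0\<close> it is solved by the monomials themselves.

  For a polynomial \<open>p\<close> apply \<open>t\<^sup>k \<mapsto> u\<^sub>k(x) \<plusminus> v\<^sub>k(x)\<close> to the translate \<open>p(t + y)\<close>. The resulting
  functions \<open>F\<^sub>+\<close>, \<open>F\<^sub>-\<close> of \<open>(x, y)\<close> solve a hyperbolic system: along the lines of constant
  \<open>x + y\<close> the function \<open>F\<^sub>+\<close> has derivative \<open>r F\<^sub>-\<close>, along the lines of constant \<open>x - y\<close> the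
  function \<open>F\<^sub>-\<close> has derivative \<open>r F\<^sub>+\<close>, and at \<open>x = x\<^sub>0\<close> they are \<open>2 p(y)\<close> and \<open>0\<close>. Integrating along
  these characteristics bounds the difference of \<open>\<Sum>\<^sub>k p\<^sub>k u\<^sub>k(x)\<close> and \<open>p(x - x\<^sub>0)\<close> in the norm with
  weight \<open>exp (- \<kappa> \<bar>x - x\<^sub>0\<bar>)\<close> by \<open>O(1/\<kappa>)\<close> times the norm of \<open>p\<close>
  (\<open>transmute_error_bound\<close>).

  For large \<open>\<kappa>\<close>, approximating a continuous \<open>h\<close> by a polynomial (Weierstrass) and transmuting it
  leaves a remainder of at most half the weighted norm of \<open>h\<close> (\<open>transmute_halves_error\<close>). Applying
  this again to the remainder, and so on, gives combinations of the \<open>u\<^sub>k\<close> that converge uniformly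
  to \<open>h\<close> (\<open>transmute_dense\<close>).
\<close>

section \<open>Transmutation of polynomials\<close>

definition transmute :: "(nat \<Rightarrow> real \<Rightarrow> complex) \<Rightarrow> complex poly \<Rightarrow> real \<Rightarrow> complex" where
  "transmute S p x = (\<Sum>j\<le>degree p. coeff p j * S j x)"

text \<open>
  The image of the translate \<open>p(t + y)\<close>, whose coefficients are written as Taylor coefficients
  of \<open>p\<close> at \<open>y\<close> so that differentiation in \<open>y\<close> only advances the order of the derivative.
\<close>

definition transmute_shift ::
  "(nat \<Rightarrow> real \<Rightarrow> complex) \<Rightarrow> complex poly \<Rightarrow> real \<Rightarrow> real \<Rightarrow> complex" where
  "transmute_shift S p x y =
     (\<Sum>j\<le>degree p. poly ((pderiv ^^ j) p) (of_real y) / fact j * S j x)"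

lemma transmute_eq_sum:
  assumes "degree p \<le> n"
  shows "transmute S p x = (\<Sum>j\<le>n. coeff p j * S j x)"
  unfolding transmute_def
  by (rule sum.mono_neutral_left) (use assms in \<open>auto simp: coeff_eq_0\<close>)

lemma transmute_add: "transmute S (p + q) x = transmute S p x + transmute S q x"
proof -
  define n where "n = max (degree p) (degree q)"
  have "degree (p + q) \<le> n" "degree p \<le> n" "degree q \<le> n"
    by (simp_all add: n_def degree_add_le_max)
  then show ?thesis
    by (simp add: transmute_eq_sum[where n = n] sum.distrib ring_distribs)
qed

lemma transmute_shift_0: "transmute_shift S p x 0 = transmute S p x"
proof -
  have "poly ((pderiv ^^ j) p) 0 / fact j = coeff p j" for j
    by (simp add: poly_0_coeff_0 coeff_higher_pderiv flip: pochhammer_fact)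
  then show ?thesis by (simp add: transmute_shift_def transmute_def)
qed

lemma transmute_shift_origin:
  assumes "\<And>j. S j x = (if j = 0 then c else 0)"
  shows "transmute_shift S p x y = c * poly p (of_real y)"
proof -
  have "transmute_shift S p x y =
      (\<Sum>j\<in>{0}. poly ((pderiv ^^ j) p) (of_real y) / fact j * S j x)"
    unfolding transmute_shift_def
    by (rule sum.mono_neutral_right) (auto simp: assms)
  then show ?thesis by (simp add: assms)
qed

lemma transmute_shift_add:
  "transmute_shift (\<lambda>j x. S j x + S' j x) p x y = transmute_shift S p x y + transmute_shift S' p x y"
  by (simp add: transmute_shift_def ring_distribs sum.distrib)

lemma continuous_on_transmute_shift:
  assumes "\<And>j. continuous_on A (S j)"
  shows "continuous_on (A \<times> UNIV) (\<lambda>z. transmute_shift S p (fst z) (snd z))"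
  unfolding transmute_shift_def
proof (intro continuous_intros)
  fix j
  show "continuous_on (A \<times> UNIV) (\<lambda>z. S j (fst z))"
    by (rule continuous_on_compose2[OF assms]) (auto intro!: continuous_intros)
qed auto

text \<open>
  The transport equation. If differentiating \<open>S\<close> lowers the index like \<open>d/dt\<close> does on monomials
  (up to the sign \<open>\<tau>\<close> and the coupling \<open>\<rho> S'\<close>), then moving \<open>x\<close> forward acts on the translated
  polynomial like moving \<open>y\<close> forward. Along \<open>y = z - \<tau> (x - x0)\<close> the two effects cancel
  and the coupling is left.
\<close>

lemma transmute_shift_has_derivative:
  fixes S S' :: "nat \<Rightarrow> real \<Rightarrow> complex" and \<tau> z x0 x :: real
  assumes S: "\<And>j. (S j has_vector_derivative \<rho> * S' j x + of_real \<tau> * of_nat j * S (j - 1) x)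
                (at x within A)"
  shows "((\<lambda>x. transmute_shift S p x (z - \<tau> * (x - x0))) has_vector_derivative
           \<rho> * transmute_shift S' p x (z - \<tau> * (x - x0))) (at x within A)"
proof -
  define Y where "Y = of_real z - of_real \<tau> * (of_real x - of_real x0 :: complex)"
  define P where "P j = poly ((pderiv ^^ j) p) Y" for j
  define n where "n = degree p"
  have dP: "((\<lambda>x. poly ((pderiv ^^ j) p) (of_real (z - \<tau> * (x - x0)))) has_vector_derivative
         - of_real \<tau> * P (Suc j)) (at x within A)" for j
  proof -
    have "((\<lambda>w. poly ((pderiv ^^ j) p) (of_real z - of_real \<tau> * (w - of_real x0)))
        has_field_derivative - of_real \<tau> * P (Suc j)) (at (of_real x))"
      unfolding P_def Y_def by (auto intro!: derivative_eq_intros)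
    from has_vector_derivative_real_field[OF this] show ?thesis by simp
  qed
  \<comment> \<open>The index shift below moves the summation range by one; the extra top term is zero.\<close>
  have P_top: "P (Suc n) = 0"
  proof -
    have "degree ((pderiv ^^ n) p) = 0" by (simp add: degree_higher_pderiv n_def)
    then have "pderiv ((pderiv ^^ n) p) = 0" by (simp add: pderiv_eq_0_iff)
    then show ?thesis by (simp add: P_def)
  qed
  have "((\<lambda>x. transmute_shift S p x (z - \<tau> * (x - x0))) has_vector_derivative
      (\<Sum>j\<le>n. P j / fact j * (\<rho> * S' j x + of_real \<tau> * of_nat j * S (j - 1) x)
            + (- of_real \<tau> * P (Suc j)) / fact j * S j x)) (at x within A)"
    unfolding transmute_shift_def n_def[symmetric]
  proof (intro has_vector_derivative_sum)
    fix j
    show "((\<lambda>x. poly ((pderiv ^^ j) p) (of_real (z - \<tau> * (x - x0))) / fact j * S j x)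
        has_vector_derivative
        P j / fact j * (\<rho> * S' j x + of_real \<tau> * of_nat j * S (j - 1) x)
            + (- of_real \<tau> * P (Suc j)) / fact j * S j x) (at x within A)"
      using has_vector_derivative_mult[OF has_vector_derivative_divide[OF dP] S]
      by (simp add: P_def Y_def)
  qed
  moreover have "(\<Sum>j\<le>n. P j / fact j * (of_nat j * S (j - 1) x)) =
      (\<Sum>j\<le>n. P (Suc j) / fact j * S j x)"
  proof -
    have "(\<Sum>j\<le>Suc n. P j / fact j * (of_nat j * S (j - 1) x)) =
       (\<Sum>j\<le>n. P (Suc j) / fact (Suc j) * (of_nat (Suc j) * S j x))"
      by (subst sum.atMost_Suc_shift) simp
    also have "\<dots> = (\<Sum>j\<le>n. P (Suc j) / fact j * S j x)"
    proof (rule sum.cong[OF refl])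
      fix j
      have "(of_nat (Suc j) :: complex) \<noteq> 0" by (simp del: of_nat_Suc)
      then show "P (Suc j) / fact (Suc j) * (of_nat (Suc j) * S j x) = P (Suc j) / fact j * S j x"
        by (simp add: fact_Suc del: of_nat_Suc)
    qed
    finally show ?thesis using P_top by simp
  qed
  then have "(\<Sum>j\<le>n. P j / fact j * (\<rho> * S' j x + of_real \<tau> * of_nat j * S (j - 1) x)
            + (- of_real \<tau> * P (Suc j)) / fact j * S j x)
      = \<rho> * (\<Sum>j\<le>n. P j / fact j * S' j x)"
  proof -
    assume shift: "(\<Sum>j\<le>n. P j / fact j * (of_nat j * S (j - 1) x)) =
      (\<Sum>j\<le>n. P (Suc j) / fact j * S j x)"
    have "(\<Sum>j\<le>n. P j / fact j * (\<rho> * S' j x + of_real \<tau> * of_nat j * S (j - 1) x)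
            + (- of_real \<tau> * P (Suc j)) / fact j * S j x)
      = (\<Sum>j\<le>n. \<rho> * (P j / fact j * S' j x) + of_real \<tau> * (P j / fact j * (of_nat j * S (j - 1) x))
          - of_real \<tau> * (P (Suc j) / fact j * S j x))"
      by (rule sum.cong) (simp_all add: algebra_simps)
    also have "\<dots> = \<rho> * (\<Sum>j\<le>n. P j / fact j * S' j x)"
      by (simp only: sum.distrib sum_subtractf sum_distrib_left[symmetric] shift) simp
    finally show ?thesis .
  qed
  ultimately show ?thesis
    by (simp add: transmute_shift_def P_def Y_def n_def)
qed

text \<open>
  A mean value inequality along the segment from \<open>x0\<close> to \<open>x\<close>, parametrised by the distance from
  \<open>x0\<close> so that both sides of \<open>x0\<close> are covered at once.
\<close>

lemma norm_increment_le:
  fixes G :: "real \<Rightarrow> complex" and \<phi> \<phi>' :: "real \<Rightarrow> real"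
  assumes x0: "x0 \<in> {a..b}" and x: "x \<in> {a..b}"
    and G: "\<And>t. t \<in> {a..b} \<Longrightarrow> (G has_vector_derivative g t) (at t within {a..b})"
    and \<phi>: "\<And>s. (\<phi> has_real_derivative \<phi>' s) (at s)"
    and bnd: "\<And>s. \<lbrakk>0 < s; s < \<bar>x - x0\<bar>\<rbrakk> \<Longrightarrow> norm (g (x0 + sgn (x - x0) * s)) \<le> \<phi>' s"
  shows "norm (G x - G x0) \<le> \<phi> \<bar>x - x0\<bar> - \<phi> 0"
proof (cases "x = x0")
  case True
  then show ?thesis by simp
next
  case False
  define \<sigma> where "\<sigma> = sgn (x - x0)"
  have \<sigma>: "\<sigma> * \<bar>x - x0\<bar> = x - x0" "\<bar>\<sigma>\<bar> = 1" "\<sigma> = 1 \<and> x > x0 \<or> \<sigma> = -1 \<and> x < x0"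
    using False by (auto simp: \<sigma>_def sgn_if)
  have Gc: "continuous_on {a..b} G"
    using G by (meson continuous_on_vector_derivative)
  have "norm (G (x0 + \<sigma> * \<bar>x - x0\<bar>) - G (x0 + \<sigma> * 0)) \<le> \<phi> \<bar>x - x0\<bar> - \<phi> 0"
  proof (rule differentiable_bound_general[where f' = "\<lambda>s. \<sigma> *\<^sub>R g (x0 + \<sigma> * s)" and \<phi>' = \<phi>'])
    show "0 < \<bar>x - x0\<bar>" using False by simp
    show "continuous_on {0..\<bar>x - x0\<bar>} (\<lambda>s. G (x0 + \<sigma> * s))"
      using \<sigma>(3) x x0
      by (intro continuous_on_compose2[OF Gc]) (auto intro!: continuous_intros)
    show "continuous_on {0..\<bar>x - x0\<bar>} \<phi>"
      using \<phi> by (meson DERIV_continuous_on has_field_derivative_at_within)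
    fix s assume s: "0 < s" "s < \<bar>x - x0\<bar>"
    have int: "a < x0 + \<sigma> * s" "x0 + \<sigma> * s < b" using \<sigma>(3) x x0 s by auto
    then have "(G has_vector_derivative g (x0 + \<sigma> * s)) (at (x0 + \<sigma> * s))"
      using G[of "x0 + \<sigma> * s"] by (simp add: at_within_Icc_at)
    moreover have "((\<lambda>s. x0 + \<sigma> * s) has_vector_derivative \<sigma>) (at s)"
      by (auto intro!: derivative_eq_intros)
    ultimately show "((\<lambda>s. G (x0 + \<sigma> * s)) has_vector_derivative \<sigma> *\<^sub>R g (x0 + \<sigma> * s)) (at s)"
      using vector_diff_chain_at[of "\<lambda>s. x0 + \<sigma> * s" \<sigma> s G "g (x0 + \<sigma> * s)"] by (simp add: o_def)
    show "(\<phi> has_vector_derivative \<phi>' s) (at s)"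
      using \<phi> by (simp add: has_real_derivative_iff_has_vector_derivative)
    show "norm (\<sigma> *\<^sub>R g (x0 + \<sigma> * s)) \<le> \<phi>' s"
      using bnd[OF s] \<sigma>(2) by (simp add: \<sigma>_def)
  qed
  then show ?thesis by (simp add: \<sigma>(1))
qed

text \<open>Weierstrass approximation applied to the real and imaginary parts.\<close>

lemma complex_poly_approximates_continuous:
  fixes g :: "real \<Rightarrow> complex"
  assumes "continuous_on {l..m} g" "e > 0"
  shows "\<exists>p::complex poly. \<forall>t\<in>{l..m}. norm (g t - poly p (of_real t)) < e"
proof -
  obtain q where q: "polynomial_function q" "\<And>t. t \<in> {l..m} \<Longrightarrow> norm (g t - q t) < e"
    using Stone_Weierstrass_polynomial_function[OF compact_Icc assms] by blast
  have real: "\<exists>p::complex poly. \<forall>t. poly p (of_real t) = of_real (s t)"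
    if s: "real_polynomial_function s" for s :: "real \<Rightarrow> real"
  proof -
    obtain c n where "s = (\<lambda>t. \<Sum>i\<le>n. c i * t ^ i)"
      using s by (auto simp: real_polynomial_function_iff_sum)
    then show ?thesis
      by (intro exI[of _ "\<Sum>i\<le>n. monom (of_real (c i)) i"]) (simp add: poly_sum poly_monom)
  qed
  obtain p1 p2 :: "complex poly" where
    "\<And>t. poly p1 (of_real t) = of_real (Re (q t))" "\<And>t. poly p2 (of_real t) = of_real (Im (q t))"
    using real[of "Re \<circ> q"] real[of "Im \<circ> q"] q(1) bounded_linear_Re bounded_linear_Im
    unfolding polynomial_function_def o_def by metis
  then have "poly (p1 + smult \<i> p2) (of_real t) = q t" for t
    by (simp add: complex_eq_iff)
  with q(2) show ?thesis by metis
qed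

section \<open>Formal powers and the characteristic estimate\<close>

text \<open>
  A perturbation of the monomials: for \<open>r = 0\<close> the only solution is
  \<open>u k x = v k x = (x - x0) ^ k\<close>.
\<close>

locale formal_powers =
  fixes a b x0 R :: real and r :: "real \<Rightarrow> complex" and u v :: "nat \<Rightarrow> real \<Rightarrow> complex"
  assumes x0: "x0 \<in> {a..b}"
    and R_pos: "R > 0"
    and r_bound: "\<And>x. x \<in> {a..b} \<Longrightarrow> norm (r x) \<le> R"
    and u_deriv: "\<And>k x. x \<in> {a..b} \<Longrightarrow>
      (u k has_vector_derivative r x * u k x + of_nat k * v (k - 1) x) (at x within {a..b})"
    and v_deriv: "\<And>k x. x \<in> {a..b} \<Longrightarrow>
      (v k has_vector_derivative of_nat k * u (k - 1) x - r x * v k x) (at x within {a..b})"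
    and u_x0: "\<And>k. u k x0 = (if k = 0 then 1 else 0)"
    and v_x0: "\<And>k. v k x0 = (if k = 0 then 1 else 0)"
begin

text \<open>
  The sum and the difference of \<open>u\<close> and \<open>v\<close> are the combinations in which the unperturbed system
  decouples into two transport equations of opposite speeds.
\<close>

definition F_plus where "F_plus p = transmute_shift (\<lambda>k x. u k x + v k x) p"
definition F_minus where "F_minus p = transmute_shift (\<lambda>k x. u k x - v k x) p"

lemma continuous_uv:
  "continuous_on {a..b} (u k)" "continuous_on {a..b} (v k)"
  by (rule continuous_on_vector_derivative, erule u_deriv v_deriv)+

lemma F_plus_deriv:
  assumes x: "x \<in> {a..b}"
  shows "((\<lambda>x. F_plus p x (z - (x - x0))) has_vector_derivative
           r x * F_minus p x (z - (x - x0))) (at x within {a..b})"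
proof -
  have "((\<lambda>x. u j x + v j x) has_vector_derivative
      r x * (u j x - v j x) + of_real 1 * of_nat j * (u (j - 1) x + v (j - 1) x)) (at x within {a..b})" for j
    by (rule has_vector_derivative_eq_rhs[OF has_vector_derivative_add[OF u_deriv[OF x] v_deriv[OF x]]])
       (simp add: algebra_simps)
  from transmute_shift_has_derivative[where S = "\<lambda>j x. u j x + v j x"
      and S' = "\<lambda>j x. u j x - v j x", OF this]
  show ?thesis by (simp add: F_plus_def F_minus_def)
qed

lemma F_minus_deriv:
  assumes x: "x \<in> {a..b}"
  shows "((\<lambda>x. F_minus p x (z + (x - x0))) has_vector_derivative
           r x * F_plus p x (z + (x - x0))) (at x within {a..b})"
proof -
  have "((\<lambda>x. u j x - v j x) has_vector_derivative
      r x * (u j x + v j x) + of_real (- 1) * of_nat j * (u (j - 1) x - v (j - 1) x)) (at x within {a..b})" for j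
    by (rule has_vector_derivative_eq_rhs[OF has_vector_derivative_diff[OF u_deriv[OF x] v_deriv[OF x]]])
       (simp add: algebra_simps)
  note D = transmute_shift_has_derivative[where S = "\<lambda>j x. u j x - v j x"
      and S' = "\<lambda>j x. u j x + v j x", OF this, of p z x0]
  have "z - - 1 * (t - x0) = z + (t - x0)" for t by simp
  then show ?thesis using D by (simp only: F_plus_def F_minus_def)
qed

lemma F_plus_x0: "F_plus p x0 y = 2 * poly p (of_real y)"
  unfolding F_plus_def by (rule transmute_shift_origin) (simp add: u_x0 v_x0)

lemma F_minus_x0: "F_minus p x0 y = 0"
  unfolding F_minus_def by (subst transmute_shift_origin[where c = 0]) (simp_all add: u_x0 v_x0)

lemma transmute_u_eq: "transmute u p x = (F_plus p x 0 + F_minus p x 0) / 2"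
proof -
  have "F_plus p x 0 + F_minus p x 0 = transmute_shift (\<lambda>k x. 2 * u k x) p x 0"
    unfolding F_plus_def F_minus_def
    by (subst transmute_shift_add[symmetric]) simp
  also have "\<dots> = 2 * transmute u p x"
    unfolding transmute_shift_0 by (simp add: transmute_def sum_distrib_left mult_ac)
  finally show ?thesis by simp
qed

text \<open>
  The Volterra estimate. The factor \<open>1 / \<kappa>\<close> comes from the only source term, \<open>2 p(x - x0 + y)\<close>
  inside \<open>F_plus\<close>: it enters \<open>F_minus\<close> through an integral of \<open>p\<close> along a characteristic, on which
  \<open>exp (\<kappa> * \<bar>t\<bar>)\<close> integrates to at most a multiple of its largest value divided by \<open>\<kappa>\<close>. The mutual
  coupling of the two deviations \<open>D1\<close>, \<open>D2\<close> from the unperturbed solution gains nothing from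
  \<open>\<kappa>\<close>; it is absorbed by the second weight \<open>exp (2 * R * \<bar>x - x0\<bar>)\<close>. The estimates take place on
  the region \<open>\<bar>x - x0\<bar> + \<bar>y\<bar> \<le> c\<close>, which is closed under running back along characteristics to
  \<open>x0\<close>, and which only sees \<open>p\<close> on \<open>[- c, c]\<close>.
\<close>

lemma transmute_error_bound:
  fixes p :: "complex poly" and \<kappa> c N :: real
  assumes \<kappa>: "\<kappa> > 0"
    and c: "\<And>x. x \<in> {a..b} \<Longrightarrow> \<bar>x - x0\<bar> \<le> c"
    and N: "\<And>t. \<bar>t\<bar> \<le> c \<Longrightarrow> norm (poly p (of_real t)) \<le> N * exp (\<kappa> * \<bar>t\<bar>)"
    and x: "x \<in> {a..b}"
  shows "norm (transmute u p x - poly p (of_real (x - x0)))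
           \<le> 4 * R / \<kappa> * exp (2 * R * c) * N * exp (\<kappa> * \<bar>x - x0\<bar>)"
proof -
  define D1 where "D1 x y = F_plus p x y - 2 * poly p (of_real (x - x0 + y))" for x y
  define D2 where "D2 x y = F_minus p x y" for x y
  define w where "w x y = exp (2 * R * \<bar>x - x0\<bar>) * exp (\<kappa> * (\<bar>x - x0\<bar> + \<bar>y\<bar>))" for x y
  define K where "K = {z \<in> {a..b} \<times> UNIV. \<bar>fst z - x0\<bar> + \<bar>snd z\<bar> \<le> c}"
  define M where "M z = max (norm (D1 (fst z) (snd z))) (norm (D2 (fst z) (snd z))) / w (fst z) (snd z)" for z
  have w_pos: "w x y > 0" for x y by (simp add: w_def)
  have c0: "0 \<le> c" using c[OF x0] by simp
  have N0: "0 \<le> N" using order_trans[OF norm_ge_zero N[of 0]] c0 by simp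
  have "compact K"
  proof -
    have "K = ({a..b} \<times> {-c..c}) \<inter> {z. \<bar>fst z - x0\<bar> + \<bar>snd z\<bar> \<le> c}"
      by (auto simp: K_def)
    moreover have "closed {z::real\<times>real. \<bar>fst z - x0\<bar> + \<bar>snd z\<bar> \<le> c}"
      by (intro closed_Collect_le continuous_intros)
    ultimately show ?thesis by (simp add: compact_Times compact_Int_closed)
  qed
  moreover have "(x0, 0) \<in> K" using x0 c0 by (auto simp: K_def)
  moreover have "continuous_on K M"
  proof -
    have F: "continuous_on ({a..b} \<times> UNIV) (\<lambda>z. F_plus p (fst z) (snd z))"
      "continuous_on ({a..b} \<times> UNIV) (\<lambda>z. F_minus p (fst z) (snd z))"
      unfolding F_plus_def F_minus_def
      by (rule continuous_on_transmute_shift; intro continuous_intros continuous_uv)+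
    have "K \<subseteq> {a..b} \<times> UNIV" by (auto simp: K_def)
    note FK = F[THEN continuous_on_subset, OF this]
    show ?thesis
      unfolding M_def D1_def D2_def w_def by (intro continuous_intros FK) auto
  qed
  ultimately obtain z where z: "z \<in> K" and zmax: "\<And>z'. z' \<in> K \<Longrightarrow> M z' \<le> M z"
    using continuous_attains_sup[of K M] by blast
  define Q where "Q = M z"
  have Q0: "Q \<ge> 0"
    using w_pos[of "fst z" "snd z"] unfolding Q_def M_def by (intro divide_nonneg_pos) (auto simp: le_max_iff_disj)
  have Q: "norm (D1 x y) \<le> Q * w x y" "norm (D2 x y) \<le> Q * w x y"
    if "x \<in> {a..b}" "\<bar>x - x0\<bar> + \<bar>y\<bar> \<le> c" for x y
  proof -
    have "M (x, y) \<le> Q" unfolding Q_def by (rule zmax) (use that in \<open>auto simp: K_def\<close>)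
    then have "max (norm (D1 x y)) (norm (D2 x y)) \<le> Q * w x y"
      using w_pos[of x y] by (simp add: M_def divide_le_eq)
    then show "norm (D1 x y) \<le> Q * w x y" "norm (D2 x y) \<le> Q * w x y" by auto
  qed
  have exp_abs: "exp (\<kappa> * \<bar>t\<bar>) \<le> exp (\<kappa> * t) + exp (- (\<kappa> * t))" for t
    by (cases "t \<ge> 0") (simp_all add: abs_if)
  \<comment> \<open>Integrating the bound \<open>Q * w\<close> along characteristics returns a bound with \<open>Q / 2\<close> in place
      of \<open>Q\<close>, plus the source. At the point where \<open>Q\<close> is attained this bounds \<open>Q\<close> itself.\<close>
  have improved: "norm (D1 x y) \<le> (Q / 2 + 2 * R * N / \<kappa>) * w x y \<and>
       norm (D2 x y) \<le> (Q / 2 + 2 * R * N / \<kappa>) * w x y"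
    if x: "x \<in> {a..b}" and xy: "\<bar>x - x0\<bar> + \<bar>y\<bar> \<le> c" for x y
  proof -
    define d where "d = \<bar>x - x0\<bar>"
    define \<sigma> where "\<sigma> = sgn (x - x0)"
    define E where "E = exp (\<kappa> * (d + \<bar>y\<bar>))"
    have E0: "E > 0" by (simp add: E_def)
    have \<sigma>d: "x - x0 = \<sigma> * d" "d \<ge> 0" by (simp_all add: \<sigma>_def d_def sgn_if)
    have path: "x0 + \<sigma> * s \<in> {a..b}" "\<bar>\<sigma> * s\<bar> = s" "\<sigma> = 1 \<or> \<sigma> = -1" if "0 < s" "s < d" for s
      using that x x0 by (auto simp: \<sigma>_def d_def sgn_if split: if_splits)
    have W: "w (x0 + \<sigma> * s) y' \<le> exp (2 * R * s) * E"
      if "0 < s" "s < d" "s + \<bar>y'\<bar> \<le> d + \<bar>y\<bar>" for s y'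
      using that path[of s] \<kappa> by (simp add: w_def E_def)
    have wE: "w x y = exp (2 * R * d) * E" by (simp add: w_def E_def d_def)
    have "norm (F_plus p x (y + (x - x0) - (x - x0)) - F_plus p x0 (y + (x - x0) - (x0 - x0)))
        \<le> Q / 2 * E * exp (2 * R * \<bar>x - x0\<bar>) - Q / 2 * E * exp (2 * R * 0)"
    proof (rule norm_increment_le[where G = "\<lambda>t. F_plus p t (y + (x - x0) - (t - x0))"
          and \<phi> = "\<lambda>s. Q / 2 * E * exp (2 * R * s)" and \<phi>' = "\<lambda>s. R * (Q * (exp (2 * R * s) * E))",
          OF x0 x F_plus_deriv])
      fix s assume "0 < s" "s < \<bar>x - x0\<bar>"
      then have s: "0 < s" "s < d" by (simp_all add: d_def)
      define y' where "y' = y + (x - x0) - \<sigma> * s"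
      have y': "s + \<bar>y'\<bar> \<le> d + \<bar>y\<bar>"
        using path(3)[OF s] s by (auto simp: y'_def \<sigma>d(1))
      have "norm (D2 (x0 + \<sigma> * s) y') \<le> Q * w (x0 + \<sigma> * s) y'"
        by (rule Q) (use path[OF s] y' xy in \<open>auto simp: d_def\<close>)
      also have "\<dots> \<le> Q * (exp (2 * R * s) * E)"
        using W[OF s y'] Q0 by (rule mult_left_mono)
      finally have "norm (r (x0 + \<sigma> * s)) * norm (D2 (x0 + \<sigma> * s) y') \<le> R * (Q * (exp (2 * R * s) * E))"
        using r_bound[OF path(1)[OF s]] R_pos by (intro mult_mono) auto
      then show "norm (r (x0 + sgn (x - x0) * s) * F_minus p (x0 + sgn (x - x0) * s)
          (y + (x - x0) - (x0 + sgn (x - x0) * s - x0))) \<le> R * (Q * (exp (2 * R * s) * E))"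
        by (simp add: norm_mult D2_def y'_def \<sigma>_def)
    qed (auto intro!: derivative_eq_intros)
    then have "norm (D1 x y) \<le> Q / 2 * w x y - Q / 2 * E"
      by (simp add: D1_def F_plus_x0 wE d_def add_ac mult_ac)
    then have 1: "norm (D1 x y) \<le> Q / 2 * w x y"
      using Q0 E0 by (smt (verit) divide_nonneg_nonneg mult_nonneg_nonneg)
    \<comment> \<open>On the characteristic of \<open>F_minus\<close> the argument of \<open>p\<close> is \<open>2 * s + e\<close> up to sign. The even
        weight \<open>exp (\<kappa> * \<bar>t\<bar>)\<close> is replaced by the sum of two exponentials, which has an
        elementary antiderivative.\<close>
    define e where "e = \<sigma> * (y - (x - x0))"
    define \<phi> where "\<phi> s = Q / 2 * E * exp (2 * R * s) +
        R * N / \<kappa> * (exp (\<kappa> * (2 * s + e)) - exp (- (\<kappa> * (2 * s + e))))" for s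
    have "norm (F_minus p x (y - (x - x0) + (x - x0)) - F_minus p x0 (y - (x - x0) + (x0 - x0)))
        \<le> \<phi> \<bar>x - x0\<bar> - \<phi> 0"
    proof (rule norm_increment_le[where G = "\<lambda>t. F_minus p t (y - (x - x0) + (t - x0))"
          and \<phi> = \<phi> and \<phi>' = "\<lambda>s. R * (Q * (exp (2 * R * s) * E) +
             2 * N * (exp (\<kappa> * (2 * s + e)) + exp (- (\<kappa> * (2 * s + e)))))",
          OF x0 x F_minus_deriv])
      fix s
      show "(\<phi> has_real_derivative R * (Q * (exp (2 * R * s) * E) +
             2 * N * (exp (\<kappa> * (2 * s + e)) + exp (- (\<kappa> * (2 * s + e)))))) (at s)"
        unfolding \<phi>_def using \<kappa> by (auto intro!: derivative_eq_intros simp: field_simps)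
      assume "0 < s" "s < \<bar>x - x0\<bar>"
      then have s: "0 < s" "s < d" by (simp_all add: d_def)
      define y' where "y' = y - (x - x0) + \<sigma> * s"
      have y': "s + \<bar>y'\<bar> \<le> d + \<bar>y\<bar>"
        using path(3)[OF s] s by (auto simp: y'_def \<sigma>d(1))
      have "norm (D1 (x0 + \<sigma> * s) y') \<le> Q * w (x0 + \<sigma> * s) y'"
        by (rule Q) (use path[OF s] y' xy in \<open>auto simp: d_def\<close>)
      also have "\<dots> \<le> Q * (exp (2 * R * s) * E)"
        using W[OF s y'] Q0 by (rule mult_left_mono)
      finally have D: "norm (D1 (x0 + \<sigma> * s) y') \<le> Q * (exp (2 * R * s) * E)" .
      define t where "t = \<sigma> * s + y'"
      have abs_t: "\<bar>t\<bar> = \<bar>2 * s + e\<bar>" "\<bar>t\<bar> \<le> c"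
        using path(3)[OF s] y' s xy by (auto simp: t_def y'_def e_def \<sigma>d(1))
      have "norm (poly p (of_real t)) \<le> N * exp (\<kappa> * \<bar>2 * s + e\<bar>)"
        using N[OF abs_t(2)] abs_t(1) by simp
      also have "exp (\<kappa> * \<bar>2 * s + e\<bar>) \<le> exp (\<kappa> * (2 * s + e)) + exp (- (\<kappa> * (2 * s + e)))"
        by (rule exp_abs)
      finally have P: "norm (poly p (of_real t)) \<le> N * (exp (\<kappa> * (2 * s + e)) + exp (- (\<kappa> * (2 * s + e))))"
        using N0 by (simp add: mult_left_mono)
      have "F_plus p (x0 + \<sigma> * s) y' = D1 (x0 + \<sigma> * s) y' + 2 * poly p (of_real t)"
        by (simp add: D1_def t_def)
      then have "norm (F_plus p (x0 + \<sigma> * s) y') \<le> norm (D1 (x0 + \<sigma> * s) y') + 2 * norm (poly p (of_real t))"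
        by (metis norm_triangle_ineq norm_mult norm_numeral)
      also have "\<dots> \<le> Q * (exp (2 * R * s) * E) +
             2 * N * (exp (\<kappa> * (2 * s + e)) + exp (- (\<kappa> * (2 * s + e))))"
        using D P by simp
      finally have "norm (r (x0 + \<sigma> * s)) * norm (F_plus p (x0 + \<sigma> * s) y')
          \<le> R * (Q * (exp (2 * R * s) * E) +
             2 * N * (exp (\<kappa> * (2 * s + e)) + exp (- (\<kappa> * (2 * s + e)))))"
        using r_bound[OF path(1)[OF s]] R_pos by (intro mult_mono) auto
      then show "norm (r (x0 + sgn (x - x0) * s) * F_plus p (x0 + sgn (x - x0) * s)
          (y - (x - x0) + (x0 + sgn (x - x0) * s - x0))) \<le> R * (Q * (exp (2 * R * s) * E) +
             2 * N * (exp (\<kappa> * (2 * s + e)) + exp (- (\<kappa> * (2 * s + e)))))"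
        by (simp add: norm_mult y'_def \<sigma>_def)
    qed
    then have "norm (D2 x y) \<le> \<phi> d - \<phi> 0"
      by (simp add: D2_def F_minus_x0 d_def)
    also have "\<dots> \<le> Q / 2 * w x y + R * N / \<kappa> * (2 * E)"
    proof -
      have "2 * d + e \<le> d + \<bar>y\<bar>" "- e \<le> d + \<bar>y\<bar>"
        by (auto simp: e_def \<sigma>_def d_def sgn_if)
      then have "exp (\<kappa> * (2 * d + e)) \<le> E" "exp (- (\<kappa> * e)) \<le> E"
        using \<kappa> mult_left_mono[of "- e" "d + \<bar>y\<bar>" \<kappa>] by (simp_all add: E_def)
      then have "exp (\<kappa> * (2 * d + e)) - exp (- (\<kappa> * (2 * d + e))) - exp (\<kappa> * e) + exp (- (\<kappa> * e)) \<le> 2 * E"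
        using exp_gt_zero[of "\<kappa> * e"] exp_gt_zero[of "- (\<kappa> * (2 * d + e))"] by linarith
      then have "R * N / \<kappa> * (exp (\<kappa> * (2 * d + e)) - exp (- (\<kappa> * (2 * d + e))) - exp (\<kappa> * e) + exp (- (\<kappa> * e)))
          \<le> R * N / \<kappa> * (2 * E)"
        using R_pos N0 \<kappa> by (intro mult_left_mono) auto
      moreover have "0 \<le> Q / 2 * E" using Q0 E0 by simp
      ultimately show ?thesis
        by (simp add: \<phi>_def wE algebra_simps)
    qed
    also have "\<dots> \<le> (Q / 2 + 2 * R * N / \<kappa>) * w x y"
    proof -
      have "1 * E \<le> w x y" unfolding wE using E0 R_pos \<sigma>d(2) by (intro mult_right_mono) auto
      then have "(2 * R * N / \<kappa>) * E \<le> (2 * R * N / \<kappa>) * w x y"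
        using R_pos N0 \<kappa> by (intro mult_left_mono) auto
      then show ?thesis by (simp add: algebra_simps)
    qed
    finally have 2: "norm (D2 x y) \<le> (Q / 2 + 2 * R * N / \<kappa>) * w x y" .
    have "0 \<le> (2 * R * N / \<kappa>) * w x y"
      using R_pos N0 \<kappa> w_pos[of x y] by simp
    then have "norm (D1 x y) \<le> (Q / 2 + 2 * R * N / \<kappa>) * w x y"
      using 1 by (simp add: distrib_right)
    with 2 show ?thesis by simp
  qed
  have "Q \<le> Q / 2 + 2 * R * N / \<kappa>"
  proof -
    have "fst z \<in> {a..b}" "\<bar>fst z - x0\<bar> + \<bar>snd z\<bar> \<le> c" using z by (auto simp: K_def)
    from improved[OF this] show ?thesis
      using w_pos[of "fst z" "snd z"] by (simp add: Q_def M_def divide_le_eq)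
  qed
  then have Q_le: "Q \<le> 4 * R / \<kappa> * N" by simp
  have "transmute u p x - poly p (of_real (x - x0)) = (D1 x 0 + D2 x 0) / 2"
    by (simp add: transmute_u_eq D1_def D2_def diff_divide_distrib add_divide_distrib)
  then have "norm (transmute u p x - poly p (of_real (x - x0))) \<le> (norm (D1 x 0) + norm (D2 x 0)) / 2"
    using norm_triangle_ineq[of "D1 x 0" "D2 x 0"] by (simp only: norm_divide norm_numeral) simp
  also have "\<dots> \<le> Q * w x 0" using Q[of x 0] x c[OF x] by simp
  also have "\<dots> \<le> (4 * R / \<kappa> * N) * (exp (2 * R * c) * exp (\<kappa> * \<bar>x - x0\<bar>))"
  proof (rule mult_mono[OF Q_le])
    show "w x 0 \<le> exp (2 * R * c) * exp (\<kappa> * \<bar>x - x0\<bar>)"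
      using c[OF x] R_pos by (simp add: w_def)
    show "0 \<le> 4 * R / \<kappa> * N" using R_pos N0 \<kappa> by simp
  qed (use w_pos[of x 0] in simp)
  finally show ?thesis by (simp add: mult_ac)
qed

section \<open>Density of the transmuted polynomials\<close>

text \<open>With this rate the constant in \<open>transmute_error_bound\<close> equals \<open>1/4\<close> for \<open>c = b - a\<close>.\<close>

definition weight_rate :: real where
  "weight_rate = 16 * R * exp (2 * R * (b - a))"

lemma weight_rate_pos: "weight_rate > 0"
  using R_pos by (simp add: weight_rate_def)

text \<open>
  The polynomial \<open>p\<close> must be controlled on all of \<open>[- c, c]\<close>, although \<open>h\<close> lives on \<open>[a, b]\<close>.
  Extending \<open>h\<close> by its boundary values does not increase the weighted norm, because clamping to
  \<open>[a, b]\<close> brings points closer to \<open>x0\<close>. Approximating up to \<open>B / 8\<close>, the total error is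
  \<open>1/8 + 1/4 * 9/8 < 1/2\<close> in units of \<open>B\<close>.
\<close>

lemma transmute_halves_error:
  assumes h: "continuous_on {a..b} h" and B: "B > 0"
    and hB: "\<And>x. x \<in> {a..b} \<Longrightarrow> norm (h x) \<le> B * exp (weight_rate * \<bar>x - x0\<bar>)"
  shows "\<exists>p. \<forall>x\<in>{a..b}. norm (h x - transmute u p x) \<le> B / 2 * exp (weight_rate * \<bar>x - x0\<bar>)"
proof -
  define c where "c = b - a"
  define \<kappa> where "\<kappa> = weight_rate"
  note hB = hB[folded \<kappa>_def]
  have \<kappa>: "\<kappa> > 0" using weight_rate_pos by (simp add: \<kappa>_def)
  have c: "\<bar>x - x0\<bar> \<le> c" if "x \<in> {a..b}" for x using that x0 by (auto simp: c_def)
  define clamp where "clamp t = max a (min b (x0 + t))" for t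
  have clamp: "clamp t \<in> {a..b}" "\<bar>clamp t - x0\<bar> \<le> \<bar>t\<bar>" for t
    using x0 by (auto simp: clamp_def)
  have "continuous_on {-c..c} (\<lambda>t. h (clamp t))"
    using clamp(1) by (intro continuous_on_compose2[OF h]) (auto simp: clamp_def intro!: continuous_intros)
  moreover have "B / 8 > 0" using B by simp
  ultimately have "\<exists>p::complex poly. \<forall>t\<in>{-c..c}. norm (h (clamp t) - poly p (of_real t)) < B / 8"
    by (rule complex_poly_approximates_continuous)
  then obtain p :: "complex poly" where
    p: "\<forall>t\<in>{-c..c}. norm (h (clamp t) - poly p (of_real t)) < B / 8"
    by (rule exE)
  show ?thesis
    unfolding \<kappa>_def[symmetric]
  proof (intro exI ballI)
    fix x assume x: "x \<in> {a..b}"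
    have N: "norm (poly p (of_real t)) \<le> 9 / 8 * B * exp (\<kappa> * \<bar>t\<bar>)" if "\<bar>t\<bar> \<le> c" for t
    proof -
      have "norm (h (clamp t) - poly p (of_real t)) < B / 8" by (rule bspec[OF p]) (use that in auto)
      moreover have "norm (poly p (of_real t)) \<le> norm (h (clamp t)) + norm (h (clamp t) - poly p (of_real t))"
        by (metis norm_minus_commute norm_triangle_sub)
      moreover have "norm (h (clamp t)) \<le> B * exp (\<kappa> * \<bar>t\<bar>)"
      proof -
        have "exp (\<kappa> * \<bar>clamp t - x0\<bar>) \<le> exp (\<kappa> * \<bar>t\<bar>)" using clamp(2) \<kappa> by simp
        then show ?thesis using hB[OF clamp(1)[of t]] B by (smt (verit) mult_left_mono)
      qed
      moreover have "B / 8 * 1 \<le> B / 8 * exp (\<kappa> * \<bar>t\<bar>)" using B \<kappa> by (intro mult_left_mono) auto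
      ultimately show ?thesis by (simp add: algebra_simps)
    qed
    have "norm (transmute u p x - poly p (of_real (x - x0)))
           \<le> 4 * R / \<kappa> * exp (2 * R * c) * (9 / 8 * B) * exp (\<kappa> * \<bar>x - x0\<bar>)"
      by (rule transmute_error_bound[OF \<kappa> c N x])
    also have "4 * R / \<kappa> * exp (2 * R * c) = 1 / 4" using R_pos by (simp add: \<kappa>_def weight_rate_def c_def)
    finally have "norm (transmute u p x - poly p (of_real (x - x0))) \<le> 9 / 32 * B * exp (\<kappa> * \<bar>x - x0\<bar>)"
      by simp
    moreover have "norm (h x - poly p (of_real (x - x0))) < B / 8"
    proof -
      have "clamp (x - x0) = x" "x - x0 \<in> {-c..c}" using x c[OF x] by (auto simp: clamp_def)
      with bspec[OF p, of "x - x0"] show ?thesis by simp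
    qed
    moreover have "norm (h x - transmute u p x) \<le> norm (h x - poly p (of_real (x - x0)))
        + norm (transmute u p x - poly p (of_real (x - x0)))"
      by (metis dist_norm dist_triangle2)
    moreover have "B * 1 \<le> B * exp (\<kappa> * \<bar>x - x0\<bar>)" using B \<kappa> by (intro mult_left_mono) auto
    ultimately show "norm (h x - transmute u p x) \<le> B / 2 * exp (\<kappa> * \<bar>x - x0\<bar>)"
      using B by argo
  qed
qed

theorem transmute_dense:
  assumes h: "continuous_on {a..b} h" and \<epsilon>: "\<epsilon> > 0"
  shows "\<exists>p. \<forall>x\<in>{a..b}. norm (h x - transmute u p x) < \<epsilon>"
proof -
  define \<kappa> where "\<kappa> = weight_rate"
  have \<kappa>: "\<kappa> > 0" using weight_rate_pos by (simp add: \<kappa>_def)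
  note halve = transmute_halves_error[folded \<kappa>_def]
  obtain B where B: "B > 0" and hB: "\<And>x. x \<in> {a..b} \<Longrightarrow> norm (h x) \<le> B"
    using compact_imp_bounded[OF compact_continuous_image[OF h]] by (auto simp: bounded_pos)
  have iter: "\<exists>p. \<forall>x\<in>{a..b}. norm (h x - transmute u p x) \<le> B / 2 ^ n * exp (\<kappa> * \<bar>x - x0\<bar>)" for n
  proof (induction n)
    case 0
    have "norm (h x) \<le> B * exp (\<kappa> * \<bar>x - x0\<bar>)" if "x \<in> {a..b}" for x
    proof -
      have "B * 1 \<le> B * exp (\<kappa> * \<bar>x - x0\<bar>)" using B \<kappa> by (intro mult_left_mono) auto
      then show ?thesis using hB[OF that] by simp
    qed
    then show ?case by (intro exI[of _ 0]) (simp add: transmute_def)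
  next
    case (Suc n)
    then obtain p where p: "\<And>x. x \<in> {a..b} \<Longrightarrow>
        norm (h x - transmute u p x) \<le> B / 2 ^ n * exp (\<kappa> * \<bar>x - x0\<bar>)" by blast
    have "continuous_on {a..b} (\<lambda>x. h x - transmute u p x)"
      unfolding transmute_def by (intro continuous_intros h continuous_uv)
    from halve[OF this _ p] B have "\<exists>q. \<forall>x\<in>{a..b}.
        norm (h x - transmute u p x - transmute u q x) \<le> B / 2 ^ n / 2 * exp (\<kappa> * \<bar>x - x0\<bar>)"
      by simp
    then obtain q where q: "\<forall>x\<in>{a..b}.
        norm (h x - transmute u p x - transmute u q x) \<le> B / 2 ^ n / 2 * exp (\<kappa> * \<bar>x - x0\<bar>)"
      by (rule exE)
    show ?case
      by (intro exI[of _ "p + q"] ballI)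
         (use q in \<open>simp add: transmute_add diff_diff_eq mult_ac\<close>)
  qed
  define C where "C = B * exp (\<kappa> * (b - a))"
  have "C > 0" using B by (simp add: C_def)
  obtain n where n: "(1 / 2) ^ n < \<epsilon> / C"
    using real_arch_pow_inv[of "\<epsilon> / C" "1 / 2"] \<open>C > 0\<close> \<epsilon> by auto
  obtain p where p: "\<And>x. x \<in> {a..b} \<Longrightarrow>
      norm (h x - transmute u p x) \<le> B / 2 ^ n * exp (\<kappa> * \<bar>x - x0\<bar>)" using iter by blast
  show ?thesis
  proof (intro exI ballI)
    fix x assume x: "x \<in> {a..b}"
    have "exp (\<kappa> * \<bar>x - x0\<bar>) \<le> exp (\<kappa> * (b - a))" using x x0 \<kappa> by auto
    then have "B / 2 ^ n * exp (\<kappa> * \<bar>x - x0\<bar>) \<le> B / 2 ^ n * exp (\<kappa> * (b - a))"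
      using B by (intro mult_left_mono) auto
    also have "\<dots> = C * (1 / 2) ^ n" by (simp add: C_def power_one_over)
    also have "\<dots> < \<epsilon>" using n \<open>C > 0\<close> by (simp add: field_simps)
    finally show "norm (h x - transmute u p x) < \<epsilon>" using p[OF x] by simp
  qed
qed

end

section \<open>The recursive integrals as formal powers\<close>

lemma powi_alternating: "(z::complex) powi ((- 1) ^ n) = (if even n then z else inverse z)"
  by (cases "even n") (simp_all add: power_int_minus)

locale nonvanishing_C1 =
  fixes a b x0 :: real and f f' :: "real \<Rightarrow> complex"
  assumes x0: "x0 \<in> {a..b}"
    and f_deriv: "\<And>x. x \<in> {a..b} \<Longrightarrow> (f has_vector_derivative f' x) (at x within {a..b})"
    and f'_cont: "continuous_on {a..b} f'"
    and f_nz: "\<And>x. x \<in> {a..b} \<Longrightarrow> f x \<noteq> 0"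
begin

lemma f_cont: "continuous_on {a..b} f"
  by (rule continuous_on_vector_derivative, erule f_deriv)

lemma continuous_weight: "continuous_on {a..b} (\<lambda>s. ((f s)\<^sup>2) powi ((- 1) ^ n))"
  unfolding powi_alternating
  by (cases "even n") (auto intro!: continuous_intros f_cont simp: f_nz)

lemma recursive_integral_deriv:
  assumes G: "continuous_on {a..b} G" and x: "x \<in> {a..b}"
  shows "((\<lambda>x. of_nat m * (LBINT s=x0..x. G s * ((f s)\<^sup>2) powi ((- 1) ^ n))) has_vector_derivative
     of_nat m * (G x * ((f x)\<^sup>2) powi ((- 1) ^ n))) (at x within {a..b})"
proof (rule has_vector_derivative_mult_right)
  show "((\<lambda>x. LBINT s=x0..x. G s * ((f s)\<^sup>2) powi ((- 1) ^ n)) has_vector_derivative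
     G x * ((f x)\<^sup>2) powi ((- 1) ^ n)) (at x within {a..b})"
    by (rule interval_integral_FTC2) (use x0 x in \<open>auto intro!: continuous_intros G continuous_weight\<close>)
qed

lemma X_tilde_continuous: "continuous_on {a..b} (X_tilde f x0 n)"
proof (induction n)
  case (Suc n)
  show ?case
    by (rule continuous_on_vector_derivative, subst X_tilde.simps, rule recursive_integral_deriv[OF Suc])
qed simp

lemma X_plain_continuous: "continuous_on {a..b} (X_plain f x0 n)"
proof (induction n)
  case (Suc n)
  show ?case
    by (rule continuous_on_vector_derivative, subst X_plain.simps, rule recursive_integral_deriv[OF Suc])
qed simp

lemma X_tilde_deriv:
  assumes "x \<in> {a..b}"
  shows "(X_tilde f x0 k has_vector_derivative of_nat k * X_tilde f x0 (k - 1) x *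
     (if even k then inverse ((f x)\<^sup>2) else (f x)\<^sup>2)) (at x within {a..b})"
proof (cases k)
  case (Suc n)
  then show ?thesis
    using recursive_integral_deriv[OF X_tilde_continuous assms, of "Suc n" n n]
    unfolding powi_alternating by (cases "even n") (simp_all add: mult.assoc)
qed simp

lemma X_plain_deriv:
  assumes "x \<in> {a..b}"
  shows "(X_plain f x0 k has_vector_derivative of_nat k * X_plain f x0 (k - 1) x *
     (if even k then (f x)\<^sup>2 else inverse ((f x)\<^sup>2))) (at x within {a..b})"
proof (cases k)
  case (Suc n)
  then show ?thesis
    using recursive_integral_deriv[OF X_plain_continuous assms, of "Suc n" n "Suc n"]
    unfolding powi_alternating by (cases "even n") (simp_all add: mult.assoc)
qed simp

lemma X_tilde_x0: "X_tilde f x0 k x0 = (if k = 0 then 1 else 0)"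
  by (cases k) auto

lemma X_plain_x0: "X_plain f x0 k x0 = (if k = 0 then 1 else 0)"
  by (cases k) auto

text \<open>
  Up to constants \<open>u\<close> is \<open>phi\<close>, and \<open>v\<close> is the same construction for \<open>1/f\<close>, which exchanges
  \<open>X_tilde\<close> and \<open>X_plain\<close>. The constants \<open>f x0\<close> normalise the values at \<open>x0\<close> and are placed so that
  the coupling coefficients in both recursions are exactly \<open>k\<close>.
\<close>

definition u where
  "u k x = (if even k then f x / f x0 * X_tilde f x0 k x else f x0 * f x * X_plain f x0 k x)"

definition v where
  "v k x = (if even k then f x0 / f x * X_plain f x0 k x else X_tilde f x0 k x / (f x0 * f x))"

lemma u_deriv:
  assumes x: "x \<in> {a..b}"
  shows "(u k has_vector_derivative f' x / f x * u k x + of_nat k * v (k - 1) x) (at x within {a..b})"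
proof (cases "even k")
  case True
  have uk: "u k = (\<lambda>x. f x / f x0 * X_tilde f x0 k x)" using True by (simp add: u_def fun_eq_iff)
  have vk: "of_nat k * v (k - 1) x = of_nat k * (X_tilde f x0 (k - 1) x / (f x0 * f x))"
    using True by (cases "k = 0") (simp_all add: v_def)
  show ?thesis
    unfolding vk unfolding uk
    by (rule has_vector_derivative_eq_rhs[OF has_vector_derivative_mult[OF
          has_vector_derivative_divide[OF f_deriv[OF x]] X_tilde_deriv[OF x]]])
       (use True f_nz[OF x] f_nz[OF x0] in \<open>simp add: field_simps power2_eq_square\<close>)
next
  case False
  have uk: "u k = (\<lambda>x. f x0 * f x * X_plain f x0 k x)" using False by (simp add: u_def fun_eq_iff)
  have vk: "v (k - 1) x = f x0 / f x * X_plain f x0 (k - 1) x"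
    using False by (simp add: v_def)
  show ?thesis
    unfolding vk unfolding uk
    by (rule has_vector_derivative_eq_rhs[OF has_vector_derivative_mult[OF
          has_vector_derivative_mult_right[OF f_deriv[OF x]] X_plain_deriv[OF x]]])
       (use False f_nz[OF x] f_nz[OF x0] in \<open>simp add: field_simps power2_eq_square\<close>)
qed

lemma v_deriv:
  assumes x: "x \<in> {a..b}"
  shows "(v k has_vector_derivative of_nat k * u (k - 1) x - f' x / f x * v k x) (at x within {a..b})"
proof -
  have "((inverse \<circ> f) has_vector_derivative f' x * - (inverse (f x) ^ Suc (Suc 0))) (at x within {a..b})"
    by (rule field_vector_diff_chain_within[OF f_deriv[OF x]
          has_field_derivative_at_within[OF DERIV_inverse[OF f_nz[OF x]]]])
  then have inv: "((\<lambda>x. inverse (f x)) has_vector_derivative - f' x / (f x)\<^sup>2) (at x within {a..b})"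
    by (simp add: o_def field_simps power2_eq_square)
  show ?thesis
  proof (cases "even k")
    case True
    have vk: "v k = (\<lambda>x. f x0 * inverse (f x) * X_plain f x0 k x)"
      using True by (simp add: v_def fun_eq_iff divide_inverse)
    have uk: "of_nat k * u (k - 1) x = of_nat k * (f x0 * f x * X_plain f x0 (k - 1) x)"
      using True by (cases "k = 0") (simp_all add: u_def)
    show ?thesis
      unfolding uk unfolding vk
      by (rule has_vector_derivative_eq_rhs[OF has_vector_derivative_mult[OF
            has_vector_derivative_mult_right[OF inv] X_plain_deriv[OF x]]])
         (use True f_nz[OF x] f_nz[OF x0] in \<open>simp add: field_simps power2_eq_square\<close>)
  next
    case False
    have vk: "v k = (\<lambda>x. inverse (f x) / f x0 * X_tilde f x0 k x)"
      using False by (simp add: v_def fun_eq_iff field_simps)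
    have uk: "u (k - 1) x = f x / f x0 * X_tilde f x0 (k - 1) x"
      using False by (simp add: u_def)
    show ?thesis
      unfolding uk unfolding vk
      by (rule has_vector_derivative_eq_rhs[OF has_vector_derivative_mult[OF
            has_vector_derivative_divide[OF inv] X_tilde_deriv[OF x]]])
         (use False f_nz[OF x] f_nz[OF x0] in \<open>simp add: field_simps power2_eq_square\<close>)
  qed
qed

lemma obtain_formal_powers:
  obtains R where "formal_powers a b x0 R (\<lambda>x. f' x / f x) u v"
proof -
  have "continuous_on {a..b} (\<lambda>x. f' x / f x)"
    by (intro continuous_intros f'_cont f_cont) (simp add: f_nz)
  from compact_imp_bounded[OF compact_continuous_image[OF this]]
  obtain R where "R > 0" "\<And>x. x \<in> {a..b} \<Longrightarrow> norm (f' x / f x) \<le> R"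
    by (auto simp: bounded_pos)
  then have "formal_powers a b x0 R (\<lambda>x. f' x / f x) u v"
    by (intro formal_powers.intro x0 u_deriv v_deriv)
       (simp_all add: u_def v_def X_tilde_x0 X_plain_x0 f_nz[OF x0])
  then show thesis by (rule that)
qed

lemma transmute_u_eq_phi_sum:
  "transmute u p x =
     (\<Sum>k=0..degree p. (coeff p k * (if even k then 1 / f x0 else f x0)) * phi f x0 k x)"
  unfolding transmute_def atLeast0AtMost
  by (rule sum.cong) (auto simp: u_def phi_def)

lemma phi_continuous: "continuous_on {a..b} (phi f x0 k)"
  unfolding phi_def
  by (cases "odd k") (auto intro!: continuous_intros f_cont X_tilde_continuous X_plain_continuous)

end

theorem theorem9:
  fixes a b x0 \<epsilon> :: real and f h :: "real \<Rightarrow> complex"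
  assumes "a < b"
    and "Ck_on 2 f {a<..<b}"
    and "Ck_on 1 f {a..b}"
    and "\<And>x. x \<in> {a..b} \<Longrightarrow> f x \<noteq> 0"
    and "x0 \<in> {a..b}"
    and "h piecewise_C1_differentiable_on {a..b}"
    and "\<epsilon> > 0"
  shows "\<exists>(N::nat) (\<alpha>::nat \<Rightarrow> complex).
           let E = (\<lambda>x. norm (h x - (\<Sum>k=0..N. \<alpha> k * phi f x0 k x)))
           in \<exists>m. is_arg_max E (\<lambda>x. x \<in> {a..b}) m \<and> E m < \<epsilon>"
proof -
  obtain f' where f': "\<And>x. x \<in> {a..b} \<Longrightarrow> (f has_vector_derivative f' x) (at x within {a..b})"
    "continuous_on {a..b} f'"
    using assms(3) unfolding One_nat_def Ck_on.simps by blast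
  interpret nonvanishing_C1 a b x0 f f'
    by unfold_locales (use assms f' in auto)
  have h: "continuous_on {a..b} h"
    using assms(6) by (simp add: piecewise_C1_differentiable_on_def)
  obtain R where "formal_powers a b x0 R (\<lambda>x. f' x / f x) u v" by (rule obtain_formal_powers)
  from formal_powers.transmute_dense[OF this h \<open>\<epsilon> > 0\<close>]
  obtain p where p: "\<And>x. x \<in> {a..b} \<Longrightarrow> norm (h x - transmute u p x) < \<epsilon>" by blast
  define \<alpha> where "\<alpha> k = coeff p k * (if even k then 1 / f x0 else f x0)" for k
  define E where "E x = norm (h x - (\<Sum>k=0..degree p. \<alpha> k * phi f x0 k x))" for x
  have "continuous_on {a..b} E"
    unfolding E_def by (intro continuous_intros h phi_continuous)
  then obtain m where m: "m \<in> {a..b}" "\<And>y. y \<in> {a..b} \<Longrightarrow> E y \<le> E m"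
    using continuous_attains_sup[of "{a..b}" E] \<open>a < b\<close> by auto
  have "is_arg_max E (\<lambda>x. x \<in> {a..b}) m"
    using m by (auto simp: is_arg_max_def not_less)
  moreover have "E m < \<epsilon>"
    using p[OF m(1)] by (simp add: E_def \<alpha>_def transmute_u_eq_phi_sum)
  ultimately have "is_arg_max E (\<lambda>x. x \<in> {a..b}) m \<and> E m < \<epsilon>" ..
  then show ?thesis unfolding E_def Let_def by blast
qed

end
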